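(* Let $p$ be a prime and set $f(X)=X^{2p-1}+pX\in\mathbb{Z}[X]$. Then, for any integer $r\geq 2$, $$N(f,p^r)=p^{r-2}(p^2-p+1).$$
   Context: For a polynomial $f\in\mathbb{Z}[X]$ and an integer $m\geq 1$, $V(f\bmod m)\subseteq\mathbb{Z}/m\mathbb{Z}$ denotes the image (value set) of the function $\mathbb{Z}/m\mathbb{Z}\to\mathbb{Z}/m\mathbb{Z}$, $a\mapsto f(a)$, induced by $f$, and $N(f,m)=\#V(f\bmod m)$. *)

theory Defs
  imports
    "HOL-Number_Theory.Number_Theory"
    "HOL-Computational_Algebra.Polynomial"
begin

text \<open>
  The ring of integers modulo \<open>m\<close> is the library's \<open>residue_ring m\<close>, whose carrier is the set of
  canonical representatives \<open>{0..m-1}\<close>; reducing an integer into it is \<open>mod m\<close>. The definitions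
  below are meant for \<open>m \<ge> 1\<close>.
\<close>

definition poly_fun_mod :: "int poly \<Rightarrow> nat \<Rightarrow> int \<Rightarrow> int" where
  "poly_fun_mod f m a = poly f a mod int m"

definition value_set_mod :: "int poly \<Rightarrow> nat \<Rightarrow> int set" where
  "value_set_mod f m = poly_fun_mod f m ` carrier (residue_ring (int m))"

definition num_values_mod :: "int poly \<Rightarrow> nat \<Rightarrow> nat" where
  "num_values_mod f m = card (value_set_mod f m)"

end

theory Submission
  imports Defs
begin

text \<open>
  Since \<open>f(x) \<equiv> x (mod p)\<close>, units and non-units have disjoint images. On the units,
  \<open>f'(x) \<equiv> -1 (mod p)\<close> makes \<open>f\<close> injective modulo \<open>p\<^sup>r\<close>, which gives \<open>p\<^sup>r - p\<^sup>r\<^sup>-\<^sup>1\<close> values. On the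
  multiples of \<open>p\<close> one has \<open>f(py) = p\<^sup>2 g(y)\<close> with \<open>g(y) = y + p\<^sup>2\<^sup>p\<^sup>-\<^sup>3 y\<^sup>2\<^sup>p\<^sup>-\<^sup>1\<close>, and \<open>g\<close> permutes the
  residues modulo \<open>p\<^sup>r\<^sup>-\<^sup>2\<close> because \<open>g' \<equiv> 1 (mod p)\<close>; this gives \<open>p\<^sup>r\<^sup>-\<^sup>2\<close> further values.
\<close>

lemma fermat_int:
  fixes a :: int
  assumes "prime p"
  shows "[a ^ p = a] (mod int p)"
proof -
  define n where "n = nat (a mod int p)"
  have p: "p > 0" using assms prime_gt_0_nat by blast
  have n: "[int n = a] (mod int p)"
    unfolding n_def using p by (simp add: cong_def)
  have "[n ^ p = n] (mod p)"
  proof (cases "p dvd n")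
    case True
    then have "p dvd n ^ p" using p by (meson dvd_power dvd_trans)
    with True show ?thesis by (simp add: cong_def)
  next
    case False
    from cong_mult[OF fermat_theorem[OF assms False] cong_refl, of n] show ?thesis
      using p by (simp flip: power_Suc2)
  qed
  then have "[int n ^ p = int n] (mod int p)"
    by (metis cong_int_iff of_nat_power)
  with n show ?thesis
    by (meson cong_pow cong_sym cong_trans)
qed

text \<open>The cofactor is the sum of \<open>b ^ (n - 1 - i) * a ^ i\<close> over i < n. When a and
  b agree modulo c, each of its n terms is congruent to \<open>a ^ (n - 1)\<close>, so the divided
  difference of X^n reduces to the derivative at a.\<close>

lemma power_diff_eq_cong:
  fixes a b c :: int
  assumes "[a = b] (mod c)"
  obtains s where "a ^ n - b ^ n = (a - b) * s" "[s = int n * a ^ (n - 1)] (mod c)"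
proof
  show "a ^ n - b ^ n = (a - b) * (\<Sum>i<n. b ^ (n - Suc i) * a ^ i)"
    by (rule power_diff_sumr2)
  have "[(\<Sum>i<n. b ^ (n - Suc i) * a ^ i) = (\<Sum>i<n. a ^ (n - 1))] (mod c)"
  proof (rule cong_sum)
    fix i assume "i \<in> {..<n}"
    then have "a ^ (n - 1) = a ^ (n - Suc i) * a ^ i"
      by (simp flip: power_add)
    then show "[b ^ (n - Suc i) * a ^ i = a ^ (n - 1)] (mod c)"
      using assms by (metis cong_mult cong_pow cong_refl cong_sym)
  qed
  then show "[(\<Sum>i<n. b ^ (n - Suc i) * a ^ i) = int n * a ^ (n - 1)] (mod c)"
    by simp
qed

lemma prime_power_dvd_cancel:
  fixes x u :: int
  assumes "prime p" "\<not> int p dvd u" "int p ^ r dvd x * u"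
  shows "int p ^ r dvd x"
proof -
  have "coprime (int p ^ r) u"
    using assms(1,2) by (auto intro!: coprime_power_left_iff[THEN iffD2] prime_imp_coprime)
  then show ?thesis
    using assms(3) by (simp add: coprime_dvd_mult_left_iff)
qed

lemma inj_on_mod_interval:
  fixes h :: "int \<Rightarrow> int"
  assumes "A \<subseteq> {0..<m}"
    and "\<And>a b. a \<in> A \<Longrightarrow> b \<in> A \<Longrightarrow> m dvd h a - h b \<Longrightarrow> m dvd a - b"
  shows "inj_on (\<lambda>a. h a mod m) A"
proof (rule inj_onI)
  fix a b assume ab: "a \<in> A" "b \<in> A" and "h a mod m = h b mod m"
  then have "m dvd a - b"
    using assms(2) by (simp add: mod_eq_dvd_iff)
  then have "a mod m = b mod m" by (simp add: mod_eq_dvd_iff)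
  moreover have "a mod m = a" "b mod m = b"
    using ab assms(1) by (force intro!: mod_pos_pos_trivial)+
  ultimately show "a = b" by simp
qed

text \<open>A cofactor prime to p makes g injective modulo \<open>p ^ k\<close> on a full residue
  system, and by finiteness surjective. The domain is p times longer because y will run over the
  quotients a / p of the multiples of p below \<open>p ^ (k + 2)\<close>; the extra arguments add no
  values.\<close>

lemma image_mod_multiples:
  fixes g :: "int \<Rightarrow> int"
  assumes p: "prime p"
    and "\<And>y z. \<exists>u. g y - g z = (y - z) * u \<and> \<not> int p dvd u"
  shows "(\<lambda>y. g y mod int p ^ k) ` {0..<int p ^ Suc k} = {0..<int p ^ k}"
proof
  have pos: "int p > 0" using p prime_gt_0_nat by auto
  show "(\<lambda>y. g y mod int p ^ k) ` {0..<int p ^ Suc k} \<subseteq> {0..<int p ^ k}"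
    using pos by auto
  have "inj_on (\<lambda>y. g y mod int p ^ k) {0..<int p ^ k}"
    using assms(2) prime_power_dvd_cancel[OF p]
    by (intro inj_on_mod_interval) (simp, metis)
  then have "(\<lambda>y. g y mod int p ^ k) ` {0..<int p ^ k} = {0..<int p ^ k}"
    using pos by (intro endo_inj_surj) auto
  moreover have "{0..<int p ^ k} \<subseteq> {0..<int p ^ Suc k}" using pos by auto
  ultimately show "{0..<int p ^ k} \<subseteq> (\<lambda>y. g y mod int p ^ k) ` {0..<int p ^ Suc k}"
    by (metis image_mono)
qed

theorem lemma3p4:
  fixes p r :: nat and f :: "int poly"
  assumes "Factorial_Ring.prime p"
    and "f = Polynomial.monom 1 (2 * p - 1) + Polynomial.monom (int p) 1"
    and "r \<ge> 2"
  shows "int (num_values_mod f (p ^ r)) = int p ^ (r - 2) * (int p ^ 2 - int p + 1)"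
proof -
  define P n k where "P = int p" and "n = 2 * p - 1" and "k = r - 2"
  define F where "F = (\<lambda>a::int. a ^ n + P * a)"
  \<comment> \<open>The exponent is n - 2: two factors P are split off from
    \<open>(P * y) ^ n\<close>, as from P * (P * y).\<close>
  define g where "g = (\<lambda>y::int. y + P ^ (2 * p - 3) * y ^ n)"
  define A M where "A = {0..<P ^ r}" and "M = (*) P ` {0..<P ^ Suc k}"
  have p2: "p \<ge> 2" using assms(1) prime_ge_2_nat by blast
  have P: "prime P" "P \<ge> 2" "P > 0" using assms(1) p2 by (simp_all add: P_def)
  have r: "r = Suc (Suc k)" using assms(3) by (simp add: k_def)
  have n: "n = p + (p - 1)" "n = 2 + (2 * p - 3)"
    using p2 by (auto simp: n_def)
  have polyf: "poly f a = F a" for a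
    by (simp add: assms(2) F_def n_def P_def poly_monom)
  have F_cong: "[F a = a] (mod P)" for a
  proof -
    \<comment> \<open>With n = p + (p - 1), Fermat is applied twice: \<open>a ^ n\<close> reduces to
      \<open>a * a ^ (p - 1) = a ^ p\<close>, and then to a.\<close>
    have "[a ^ p * a ^ (p - 1) = a * a ^ (p - 1)] (mod P)"
      unfolding P_def by (intro cong_mult fermat_int assms(1) cong_refl)
    also have "a * a ^ (p - 1) = a ^ p"
      using p2 by (simp flip: power_Suc)
    also have "[a ^ p = a] (mod P)"
      unfolding P_def by (intro fermat_int assms(1))
    finally have "[a ^ n = a] (mod P)"
      by (simp add: n(1) power_add)
    then show ?thesis
      by (simp add: F_def cong_def mod_simps)
  qed
  have dvd_F: "P dvd F a mod P ^ r \<longleftrightarrow> P dvd a" for a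
    using cong_dvd_iff[OF F_cong[of a]] by (simp add: dvd_mod_iff r)
  have M: "M = {a \<in> A. P dvd a}"
  proof -
    have *: "P * y \<in> A \<longleftrightarrow> y \<in> {0..<P ^ Suc k}" for y
      using P(3) by (simp add: A_def r zero_le_mult_iff)
    show ?thesis
    proof (intro equalityI subsetI)
      fix a assume "a \<in> M"
      then obtain y where "a = P * y" "y \<in> {0..<P ^ Suc k}"
        unfolding M_def by blast
      then show "a \<in> {a \<in> A. P dvd a}" using * by simp
    next
      fix a assume "a \<in> {a \<in> A. P dvd a}"
      then obtain y where "a = P * y" "P * y \<in> A" by blast
      then show "a \<in> M" unfolding M_def using * by blast
    qed
  qed
  have inj_units: "inj_on (\<lambda>a. F a mod P ^ r) (A - M)"
  proof (rule inj_on_mod_interval)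
    show "A - M \<subseteq> {0..<P ^ r}" by (auto simp: A_def)
    fix a b assume ab: "a \<in> A - M" "b \<in> A - M" and d: "P ^ r dvd F a - F b"
    have "P dvd F a - F b" using d by (rule dvd_trans[rotated]) (simp add: r)
    then have "[F a = F b] (mod P)" by (simp add: cong_iff_dvd_diff)
    then have "[a = b] (mod P)" using F_cong by (meson cong_sym cong_trans)
    then obtain s where s: "a ^ n - b ^ n = (a - b) * s" "[s = int n * a ^ (n - 1)] (mod P)"
      by (rule power_diff_eq_cong)
    \<comment> \<open>Modulo P the cofactor \<open>s + P\<close> is \<open>n * a ^ (n - 1)\<close>,
      the derivative of F at a.\<close>
    have eq: "F a - F b = (a - b) * (s + P)"
      using s(1) by (simp add: F_def algebra_simps)
    have "\<not> P dvd s + P"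
    proof
      assume "P dvd s + P"
      then have "P dvd int n * a ^ (n - 1)"
        using cong_dvd_iff[OF s(2)] by simp
      moreover have "\<not> P dvd a" using ab M by auto
      ultimately have "P dvd int n"
        using P(1) by (metis prime_dvd_mult_iff prime_dvd_power)
      \<comment> \<open>So n is -1 modulo P, and P dividing n would force P to divide 1.\<close>
      moreover have "int n = 2 * P - 1" using p2 by (simp add: n_def P_def)
      ultimately have "P dvd 1"
        by (metis dvd_diff_right_iff dvd_triv_right)
      then show False using P by simp
    qed
    then show "P ^ r dvd a - b"
      using d prime_power_dvd_cancel[OF assms(1)] unfolding eq P_def by blast
  qed
  have g_diff: "\<exists>u. g y - g z = (y - z) * u \<and> \<not> int p dvd u" for y z
  proof -
    \<comment> \<open>Congruence modulo 1 always holds, so the factorization is available for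
      arbitrary y and z.\<close>
    obtain s where s: "y ^ n - z ^ n = (y - z) * s"
      by (rule power_diff_eq_cong[of y z 1 n]) auto
    have "g y - g z = (y - z) * (1 + P ^ (2 * p - 3) * s)"
      using arg_cong[OF s, of "(*) (P ^ (2 * p - 3))"] by (simp add: g_def algebra_simps)
    \<comment> \<open>Since p \<ge> 2, the exponent 2p - 3 is at least 1, so the cofactor is 1
      modulo P.\<close>
    moreover have "P dvd P ^ (2 * p - 3) * s"
      using p2 by (intro dvd_mult2 dvd_power) auto
    then have "\<not> P dvd 1 + P ^ (2 * p - 3) * s"
      using P by (simp add: dvd_add_left_iff)
    ultimately show ?thesis unfolding P_def by blast
  qed
  \<comment> \<open>Pulling \<open>P ^ 2\<close> out of both value and modulus leaves g modulo
    \<open>P ^ k\<close>, so the values on M correspond to residues modulo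
    \<open>P ^ k\<close>.\<close>
  have F_mult: "F (P * y) mod P ^ r = P ^ 2 * (g y mod P ^ k)" for y
  proof -
    have "P ^ n = P ^ 2 * P ^ (2 * p - 3)"
      unfolding n(2) by (rule power_add)
    then have "F (P * y) = P ^ 2 * g y"
      by (simp add: F_def g_def power_mult_distrib algebra_simps power2_eq_square)
    moreover have "P ^ r = P ^ 2 * P ^ k" by (simp add: r power2_eq_square)
    ultimately show ?thesis by (simp only: mult_mod_right)
  qed
  have "(\<lambda>a. F a mod P ^ r) ` M = (*) (P ^ 2) ` (\<lambda>y. g y mod P ^ k) ` {0..<P ^ Suc k}"
    unfolding M_def image_image F_mult ..
  also have "\<dots> = (*) (P ^ 2) ` {0..<P ^ k}"
    using image_mod_multiples[OF assms(1) g_diff] by (simp only: P_def)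
  finally have card_M: "int (card ((\<lambda>a. F a mod P ^ r) ` M)) = P ^ k"
    using P by (simp add: card_image inj_on_def)
  have "int (card M) = P ^ Suc k"
    using P by (simp add: M_def card_image inj_on_def)
  moreover have "M \<subseteq> A" "finite A" by (auto simp: M A_def)
  ultimately have "int (card (A - M)) = P ^ r - P ^ Suc k"
    using P card_mono[of A M] by (simp add: card_Diff_subset finite_subset of_nat_diff A_def)
  then have card_U: "int (card ((\<lambda>a. F a mod P ^ r) ` (A - M))) = P ^ r - P ^ Suc k"
    by (simp add: card_image[OF inj_units])
  have "value_set_mod f (p ^ r) = (\<lambda>a. F a mod P ^ r) ` A"
    by (auto simp: value_set_mod_def poly_fun_mod_def polyf A_def P_def residue_ring_def)
  also have "\<dots> = (\<lambda>a. F a mod P ^ r) ` (A - M) \<union> (\<lambda>a. F a mod P ^ r) ` M"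
    using M by auto
  finally have "num_values_mod f (p ^ r)
      = card ((\<lambda>a. F a mod P ^ r) ` (A - M) \<union> (\<lambda>a. F a mod P ^ r) ` M)"
    by (simp add: num_values_mod_def)
  also have "\<dots> = card ((\<lambda>a. F a mod P ^ r) ` (A - M)) + card ((\<lambda>a. F a mod P ^ r) ` M)"
  proof (rule card_Un_disjoint)
    \<comment> \<open>Divisibility by P separates the two images: by \<open>dvd_F\<close> a value is
      divisible by P exactly when its argument is.\<close>
    show "(\<lambda>a. F a mod P ^ r) ` (A - M) \<inter> (\<lambda>a. F a mod P ^ r) ` M = {}"
    proof -
      have "\<not> P dvd v" if "v \<in> (\<lambda>a. F a mod P ^ r) ` (A - M)" for v
        using that by (auto simp: M dvd_F)
      moreover have "P dvd v" if "v \<in> (\<lambda>a. F a mod P ^ r) ` M" for v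
        using that by (auto simp: M dvd_F)
      ultimately show ?thesis by blast
    qed
  qed (use \<open>finite A\<close> \<open>M \<subseteq> A\<close> in \<open>auto intro: finite_subset\<close>)
  finally have "int (num_values_mod f (p ^ r)) = P ^ r - P ^ Suc k + P ^ k"
    using card_M card_U by simp
  also have "\<dots> = P ^ k * (P ^ 2 - P + 1)"
    by (simp add: r algebra_simps power2_eq_square)
  finally show ?thesis by (simp add: P_def k_def)
qed

end
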